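(* Let $n,m\ge 3$ be integers, and let $C_n\square C_m$ be the Cartesian product of the cycle graphs on $n$ and $m$ vertices. The girth of the eccentric graph $E(C_n\square C_m)$ is - $0$ if both $n$ and $m$ are even; - $3$ if $n=m=3$; - $2m$ if $n$ is even and $m$ is odd (and, symmetrically, $2n$ if $n$ is odd and $m$ is even); - $4$ otherwise, i.e. if $n$ and $m$ are both odd and not both equal to $3$. In particular, the girth of $E(C_n\square C_m)$ is even except when $n=m=3$.
   Context: For a connected simple graph $G$, $d_G$ is the graph distance and $e_G(v)=\max\{d_G(u,v):u\in V(G)\}$. A vertex $u$ is eccentric to $v$ if $d_G(u,v)=e_G(v)$. The eccentric graph $E(G)$ is the simple graph on vertex set $V(G)$ in which two distinct vertices $u,v$ are adjacent iff $u$ is eccentric to $v$ or $v$ is eccentric to $u$. The girth of a graph is the length of its shortest cycle, with the convention that a graph with no cycles has girth $0$. The Cartesian product $G_1\square G_2$ has vertex set $V(G_1)\times V(G_2)$, with $(u_1,u_2)$ adjacent to $(v_1,v_2)$ iff either $u_1=v_1$ and $u_2$ is adjacent to $v_2$ in $G_2$, or $u_1$ is adjacent to $v_1$ in $G_1$ and $u_2=v_2$. *)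

theory Defs
  imports "Graph_Theory.Graph_Theory"
begin

text \<open>
  A simple graph is represented, as in the locale \<open>pair_graph\<close>, by a set of vertices together with
  a symmetric irreflexive relation: an undirected edge \<open>uv\<close> is the pair of arcs \<open>(u,v)\<close>, \<open>(v,u)\<close>.
\<close>

text \<open>Only meaningful for \<open>n \<ge> 3\<close>; for \<open>n = 1\<close>, for example, there is a loop.\<close>

definition cycle_graph :: "nat \<Rightarrow> nat pair_pre_digraph" where
  "cycle_graph n =
    \<lparr> pverts = {..<n},
      parcs = {(i, j). i < n \<and> j < n \<and> (j = Suc i mod n \<or> i = Suc j mod n)} \<rparr>"

definition cartesian_product ::
  "'a pair_pre_digraph \<Rightarrow> 'b pair_pre_digraph \<Rightarrow> ('a \<times> 'b) pair_pre_digraph"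
  (infixr \<open>\<box>\<close> 70) where
  "G \<box> H =
    \<lparr> pverts = pverts G \<times> pverts H,
      parcs = {((u1, u2), (v1, v2)).
        (u1 = v1 \<and> u1 \<in> pverts G \<and> (u2, v2) \<in> parcs H) \<or>
        ((u1, v1) \<in> parcs G \<and> u2 = v2 \<and> u2 \<in> pverts H)} \<rparr>"

text \<open>
  The library's shortest path cost for unit weights: the infimum of the lengths of the walks from
  \<open>u\<close> to \<open>v\<close>, which is \<open>\<infinity>\<close> if there is none.
\<close>

definition graph_dist :: "'a pair_pre_digraph \<Rightarrow> 'a \<Rightarrow> 'a \<Rightarrow> ereal" where
  "graph_dist G u v = wf_digraph.\<mu> (with_proj G) (\<lambda>_. 1) u v"

definition eccentricity :: "'a pair_pre_digraph \<Rightarrow> 'a \<Rightarrow> ereal" where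
  "eccentricity G v = Max ((\<lambda>u. graph_dist G u v) ` pverts G)"

definition eccentric_to :: "'a pair_pre_digraph \<Rightarrow> 'a \<Rightarrow> 'a \<Rightarrow> bool" where
  "eccentric_to G u v \<longleftrightarrow> graph_dist G u v = eccentricity G v"

definition eccentric_graph :: "'a pair_pre_digraph \<Rightarrow> 'a pair_pre_digraph" where
  "eccentric_graph G =
    \<lparr> pverts = pverts G,
      parcs = {(u, v). u \<in> pverts G \<and> v \<in> pverts G \<and> u \<noteq> v \<and>
        (eccentric_to G u v \<or> eccentric_to G v u)} \<rparr>"

text \<open>
  The library's cycles are directed, so in a symmetric digraph \<open>u, v, u\<close> counts as a cycle.
  The length bound excludes exactly these: the remaining cycles visit at least three distinct
  vertices and are the cycles of the undirected graph.
\<close>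

definition undirected_cycle :: "'a pair_pre_digraph \<Rightarrow> ('a \<times> 'a) awalk \<Rightarrow> bool" where
  "undirected_cycle G p \<longleftrightarrow> pre_digraph.cycle (with_proj G) p \<and> 3 \<le> length p"

definition girth :: "'a pair_pre_digraph \<Rightarrow> nat" where
  "girth G =
    (if \<exists>p. undirected_cycle G p
     then LEAST k. \<exists>p. undirected_cycle G p \<and> length p = k
     else 0)"

lemma pair_graph_cycle_graph:
  assumes "3 \<le> n"
  shows "pair_graph (cycle_graph n)"
proof -
  have "parcs (cycle_graph n) \<subseteq> {..<n} \<times> {..<n}"
    by (auto simp: cycle_graph_def)
  then have fin: "finite (parcs (cycle_graph n))"
    by (rule finite_subset) simp
  have "Suc i mod n \<noteq> i" if "i < n" for i
    using assms that by (cases "Suc i = n") auto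
  then show ?thesis
    using fin
    by unfold_locales (fastforce simp: cycle_graph_def symmetric_def sym_def)+
qed

lemma pair_graph_cartesian_product:
  assumes "pair_graph G" "pair_graph H"
  shows "pair_graph (G \<box> H)"
proof -
  interpret G: pair_graph G by fact
  interpret H: pair_graph H by fact
  have wf: "parcs (G \<box> H) \<subseteq> pverts (G \<box> H) \<times> pverts (G \<box> H)"
    by (auto simp: cartesian_product_def dest: G.in_arcsD1 G.in_arcsD2 H.in_arcsD1 H.in_arcsD2)
  have finV: "finite (pverts (G \<box> H))"
    by (simp add: cartesian_product_def G.pair_finite_verts H.pair_finite_verts)
  have fin: "finite (parcs (G \<box> H))"
    using wf by (rule finite_subset) (simp add: finV)
  have "sym (parcs G)" "sym (parcs H)"
    using G.pair_sym_arcs H.pair_sym_arcs by (simp_all add: symmetric_def)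
  then have "sym (parcs (G \<box> H))"
    by (auto simp: cartesian_product_def sym_def)
  moreover have "fst e \<noteq> snd e" if "e \<in> parcs (G \<box> H)" for e
    using that G.pair_no_loops H.pair_no_loops by (fastforce simp: cartesian_product_def)
  ultimately show ?thesis
    using wf finV fin by unfold_locales (auto simp: symmetric_def)
qed

lemma pair_graph_eccentric_graph:
  assumes "pair_graph G"
  shows "pair_graph (eccentric_graph G)"
proof -
  interpret G: pair_graph G by fact
  have finV: "finite (pverts (eccentric_graph G))"
    by (simp add: eccentric_graph_def G.pair_finite_verts)
  have "parcs (eccentric_graph G) \<subseteq> pverts (eccentric_graph G) \<times> pverts (eccentric_graph G)"
    by (auto simp: eccentric_graph_def)
  then have fin: "finite (parcs (eccentric_graph G))"
    by (rule finite_subset) (simp add: finV)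
  show ?thesis
    using finV fin by unfold_locales (auto simp: eccentric_graph_def symmetric_def sym_def)
qed

end

theory Submission
  imports Defs "HOL-Number_Theory.Cong"
begin

text \<open>
  Distances in \<open>C_n \<box> C_m\<close> are sums of distances in the factors, so all eccentricities equal
  \<open>n div 2 + m div 2\<close>, and two vertices are adjacent in the eccentric graph iff both coordinates are
  at maximal distance in their cycles. For even \<open>n\<close> the maximal distance relation on \<open>C_n\<close> is a perfect
  matching; for odd \<open>n\<close> it is a step by \<open>\<plusminus>(n div 2)\<close> modulo \<open>n\<close>, and as \<open>n div 2\<close> is coprime to \<open>n\<close>
  it is again a cycle of length \<open>n\<close>. So the eccentric graph is a tensor product of such graphs:
  a matching (girth 0), copies of \<open>C_{2m}\<close>, or a tensor product of two odd cycles, which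
  has 4-cycles, and triangles only if both factors are triangles.
\<close>

section \<open>Graph distances\<close>

text \<open>
  Unlike being the graph distance, these local conditions on \<open>D\<close> are inherited by products.
\<close>

definition distance_function :: "'a pair_pre_digraph \<Rightarrow> ('a \<Rightarrow> 'a \<Rightarrow> nat) \<Rightarrow> bool" where
  "distance_function G D \<longleftrightarrow>
    (\<forall>u\<in>pverts G. \<forall>v\<in>pverts G. D u v = 0 \<longleftrightarrow> u = v) \<and>
    (\<forall>u\<in>pverts G. \<forall>(v, w)\<in>parcs G. D u w \<le> Suc (D u v)) \<and>
    (\<forall>u\<in>pverts G. \<forall>v\<in>pverts G. \<forall>k. D u v = Suc k \<longrightarrow> (\<exists>w. (w, v) \<in> parcs G \<and> D u w = k))"

lemma distance_function_predecessor:
  assumes "distance_function G D" "u \<in> pverts G" "v \<in> pverts G" "D u v = Suc k"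
  shows "\<exists>w. (w, v) \<in> parcs G \<and> D u w = k"
  using assms by (simp add: distance_function_def)

text \<open>Following predecessors, each lowering \<open>D u\<close> by one, builds a walk of length
  exactly \<open>D u v\<close>. Conversely \<open>D u\<close> grows by at most one per arc and
  starts at 0, so no walk is shorter.\<close>

lemma graph_dist_eq:
  assumes "pair_wf_digraph G" "distance_function G D" "u \<in> pverts G" "v \<in> pverts G"
  shows "graph_dist G u v = ereal (D u v)"
proof -
  interpret G: pair_wf_digraph G by fact
  have cost: "G.awalk_cost (\<lambda>_. 1) p = length p" for p
    by (induction p) simp_all
  have upper: "\<exists>p. G.awalk u p v \<and> length p = D u v" if "v \<in> pverts G" for v
    using that
  proof (induction "D u v" arbitrary: v)
    case 0
    then have "u = v"
      using assms(2,3) by (auto simp: distance_function_def)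
    with 0 show ?case
      by (intro exI[of _ "[]"]) (auto simp: G.awalk_Nil_iff)
  next
    case (Suc k)
    then obtain w where w: "(w, v) \<in> parcs G" "D u w = k"
      using distance_function_predecessor[OF assms(2,3)] by metis
    with Suc.hyps(1) obtain p where "G.awalk u p w" "length p = k"
      using G.in_arcsD1 by blast
    with w show ?case
      using G.arc_implies_awalk[of "(w, v)"] Suc.hyps(2)
      by (intro exI[of _ "p @ [(w, v)]"]) auto
  qed
  have lower: "D u w \<le> D u x + length p" if "G.awalk x p w" for p x w
    using that
  proof (induction p arbitrary: x)
    case Nil
    then show ?case by (simp add: G.awalk_Nil_iff)
  next
    case (Cons e p)
    then have "e \<in> parcs G" "fst e = x" "G.awalk (snd e) p w"
      by (auto simp: G.awalk_Cons_iff)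
    moreover from this have "D u (snd e) \<le> Suc (D u x)"
      using assms(2,3) by (force simp: distance_function_def)
    ultimately show ?case
      using Cons.IH[of "snd e"] by simp
  qed
  have "D u u = 0"
    using assms(2,3) by (auto simp: distance_function_def)
  then have "ereal (D u v) \<le> G.\<mu> (\<lambda>_. 1) u v"
    unfolding G.\<mu>_def using lower[of u _ v] by (intro INF_greatest) (simp add: cost)
  moreover obtain p where "G.awalk u p v" "length p = D u v"
    using upper[OF assms(4)] by blast
  then have "G.\<mu> (\<lambda>_. 1) u v \<le> ereal (D u v)"
    using G.min_cost_le_walk_cost[of u p v "\<lambda>_. 1"] by (simp add: cost)
  ultimately show ?thesis
    unfolding graph_dist_def by simp
qed

text \<open>Every arc of the product moves only one coordinate, so the sum grows by at most one. A
  predecessor comes from the first factor while its distance is positive, and from the second factor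
  otherwise.\<close>

lemma distance_function_cartesian_product:
  assumes "distance_function G D" "distance_function H D'"
  shows "distance_function (G \<box> H) (\<lambda>(a, b) (c, d). D a c + D' b d)"
proof -
  have "\<exists>w. (w, (c, d)) \<in> parcs (G \<box> H) \<and> (case w of (x, y) \<Rightarrow> D a x + D' b y) = k"
    if V: "a \<in> pverts G" "b \<in> pverts H" "c \<in> pverts G" "d \<in> pverts H"
      and eq: "D a c + D' b d = Suc k"
    for a b c d k
  proof (cases "D a c")
    case 0
    then have "D' b d = Suc k"
      using eq by simp
    then obtain w where "(w, d) \<in> parcs H" "D' b w = k"
      using distance_function_predecessor[OF assms(2) V(2,4)] by blast
    with 0 V show ?thesis
      by (intro exI[of _ "(c, w)"]) (auto simp: cartesian_product_def)
  next
    case (Suc j)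
    then obtain w where "(w, c) \<in> parcs G" "D a w = j"
      using distance_function_predecessor[OF assms(1) V(1,3)] by blast
    with Suc V eq show ?thesis
      by (intro exI[of _ "(w, d)"]) (auto simp: cartesian_product_def)
  qed
  moreover have "D a e + D' b f \<le> Suc (D a c + D' b d)"
    if "a \<in> pverts G" "b \<in> pverts H" "((c, d), (e, f)) \<in> parcs (G \<box> H)" for a b c d e f
  proof -
    from that(3) consider "c = e" "(d, f) \<in> parcs H" | "(c, e) \<in> parcs G" "d = f"
      by (auto simp: cartesian_product_def)
    then show ?thesis
    proof cases
      case 1
      then have "D' b f \<le> Suc (D' b d)"
        using assms(2) that(2) unfolding distance_function_def by blast
      with 1 show ?thesis by simp
    next
      case 2
      then have "D a e \<le> Suc (D a c)"
        using assms(1) that(1) unfolding distance_function_def by blast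
      with 2 show ?thesis by simp
    qed
  qed
  moreover have "D a c + D' b d = 0 \<longleftrightarrow> (a, b) = (c, d)"
    if "a \<in> pverts G" "b \<in> pverts H" "c \<in> pverts G" "d \<in> pverts H" for a b c d
    using assms that by (simp add: distance_function_def)
  moreover have "pverts (G \<box> H) = pverts G \<times> pverts H"
    by (simp add: cartesian_product_def)
  ultimately show ?thesis
    unfolding distance_function_def by (simp add: split_beta)
qed

section \<open>Distances in a single cycle\<close>

text \<open>\<open>d\<close> and \<open>n - d\<close> are the lengths of the two arcs joining
  \<open>i\<close> and \<open>j\<close>. For vertices \<open>d < n\<close>, so the subtraction is
  not truncated.\<close>

definition cycle_dist :: "nat \<Rightarrow> nat \<Rightarrow> nat \<Rightarrow> nat" where
  "cycle_dist n i j = (let d = nat \<bar>int i - int j\<bar> in min d (n - d))"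

lemma cycle_dist_commute: "cycle_dist n i j = cycle_dist n j i"
  by (simp add: cycle_dist_def abs_minus_commute)

lemma Suc_mod_eq_iff:
  assumes "i < n" "j < n"
  shows "j = Suc i mod n \<longleftrightarrow> j = Suc i \<or> Suc i = n \<and> j = 0"
  using assms by (cases "Suc i = n") auto

lemma distance_function_cycle_graph:
  assumes "3 \<le> n"
  shows "distance_function (cycle_graph n) (cycle_dist n)"
proof -
  have arcs: "(i, j) \<in> parcs (cycle_graph n) \<longleftrightarrow> i < n \<and> j < n \<and>
      (j = Suc i \<or> Suc i = n \<and> j = 0 \<or> i = Suc j \<or> Suc j = n \<and> i = 0)" for i j
    using Suc_mod_eq_iff[of i n j] Suc_mod_eq_iff[of j n i] by (auto simp: cycle_graph_def)
  have "\<exists>w. (w, v) \<in> parcs (cycle_graph n) \<and> cycle_dist n u w = k"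
    if "u < n" "v < n" "cycle_dist n u v = Suc k" for u v k
  proof -
    define d where "d = nat \<bar>int u - int v\<bar>"
    have "u \<noteq> v"
      using that by (auto simp: cycle_dist_def)
    \<comment> \<open>The predecessor of \<open>v\<close> lies on the shorter arc towards
      \<open>u\<close>. In the last two cases this arc passes between \<open>n - 1\<close> and 0, so
      \<open>v\<close> moves away from \<open>u\<close> in the order of the numbers, wrapping at the
      end.\<close>
    then consider "u < v" "d \<le> n - d" | "v < u" "d \<le> n - d" | "u < v" "n - d < d" | "v < u" "n - d < d"
      by linarith
    then show ?thesis
    proof cases
      case 1
      with that show ?thesis
        by (intro exI[of _ "v - 1"]) (auto simp: cycle_dist_def d_def arcs Let_def)
    next
      case 2
      with that show ?thesis
        by (intro exI[of _ "v + 1"]) (auto simp: cycle_dist_def d_def arcs Let_def)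
    next
      case 3
      with that show ?thesis
        by (intro exI[of _ "if Suc v = n then 0 else Suc v"])
          (auto simp: cycle_dist_def d_def arcs Let_def)
    next
      case 4
      with that show ?thesis
        by (intro exI[of _ "if v = 0 then n - 1 else v - 1"])
          (auto simp: cycle_dist_def d_def arcs Let_def)
    qed
  qed
  moreover have "cycle_dist n u w \<le> Suc (cycle_dist n u v)"
    if "u < n" "(v, w) \<in> parcs (cycle_graph n)" for u v w
  proof -
    define d d' where "d = nat \<bar>int u - int v\<bar>" and "d' = nat \<bar>int u - int w\<bar>"
    \<comment> \<open>The second alternative arises when the arc joins \<open>n - 1\<close> and 0.
      Then \<open>n - d = Suc d'\<close> and \<open>n - d' = Suc d\<close>, which bounds the minimum
      again.\<close>
    have "d' \<le> Suc d \<and> d \<le> Suc d' \<or> Suc (d + d') = n"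
      using that unfolding arcs d_def d'_def by (elim conjE disjE) linarith+
    then have "min d' (n - d') \<le> Suc (min d (n - d))"
      by linarith
    then show ?thesis
      by (simp add: cycle_dist_def d_def d'_def Let_def)
  qed
  moreover have "cycle_dist n u v = 0 \<longleftrightarrow> u = v" if "u < n" "v < n" for u v
    using that by (auto simp: cycle_dist_def Let_def min_def split: if_splits)
  moreover have "pverts (cycle_graph n) = {..<n}"
    by (simp add: cycle_graph_def)
  ultimately show ?thesis
    unfolding distance_function_def by auto
qed

lemma cycle_dist_le: "cycle_dist n i j \<le> n div 2"
  by (auto simp: cycle_dist_def Let_def)

lemma cycle_dist_attained:
  assumes "i < n"
  shows "\<exists>j<n. cycle_dist n j i = n div 2"
proof -
  \<comment> \<open>A move by \<open>n div 2\<close>, downwards if there is room and otherwise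
    upwards, stays inside the range without wrapping.\<close>
  define j where "j = (if n div 2 \<le> i then i - n div 2 else i + n div 2)"
  have "nat \<bar>int j - int i\<bar> = n div 2" "j < n"
    using assms by (auto simp: j_def)
  then show ?thesis
    by (intro exI[of _ j]) (simp add: cycle_dist_def Let_def min_def)
qed

section \<open>The eccentric graph of a product of two cycles\<close>

text \<open>Both summands of the distance can be maximised independently, so every eccentricity is
  \<open>n div 2 + m div 2\<close>, and a sum reaches this bound only if both summands are maximal.
  This relation is symmetric, so the two directions of eccentricity coincide.\<close>

lemma parcs_eccentric_graph_torus:
  assumes "3 \<le> n" "3 \<le> m"
  shows "((a, b), (c, d)) \<in> parcs (eccentric_graph (cycle_graph n \<box> cycle_graph m)) \<longleftrightarrow>
    a < n \<and> b < m \<and> c < n \<and> d < m \<and> cycle_dist n a c = n div 2 \<and> cycle_dist m b d = m div 2"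
proof -
  let ?G = "cycle_graph n \<box> cycle_graph m"
  have verts: "pverts ?G = {..<n} \<times> {..<m}"
    by (simp add: cartesian_product_def cycle_graph_def)
  interpret G: pair_graph ?G
    using assms by (intro pair_graph_cartesian_product pair_graph_cycle_graph)
  have dist: "graph_dist ?G (a, b) (c, d) = ereal (cycle_dist n a c + cycle_dist m b d)"
    if "a < n" "b < m" "c < n" "d < m" for a b c d
    using graph_dist_eq[OF G.pair_wf_digraph_axioms
        distance_function_cartesian_product[OF distance_function_cycle_graph distance_function_cycle_graph]]
      assms that verts by simp
  have ecc: "eccentricity ?G (c, d) = ereal (n div 2 + m div 2)" if cd: "c < n" "d < m" for c d
    unfolding eccentricity_def
  proof (rule Max_eqI)
    show "finite ((\<lambda>u. graph_dist ?G u (c, d)) ` pverts ?G)"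
      by (simp add: verts)
    show "y \<le> ereal (n div 2 + m div 2)" if "y \<in> (\<lambda>u. graph_dist ?G u (c, d)) ` pverts ?G" for y
    proof -
      from that obtain a b where "a < n" "b < m" "y = graph_dist ?G (a, b) (c, d)"
        by (auto simp: verts)
      with dist cd show ?thesis
        using cycle_dist_le[of n a c] cycle_dist_le[of m b d] by simp
    qed
    obtain a b where "a < n" "cycle_dist n a c = n div 2" "b < m" "cycle_dist m b d = m div 2"
      using cycle_dist_attained cd by metis
    with dist cd show "ereal (n div 2 + m div 2) \<in> (\<lambda>u. graph_dist ?G u (c, d)) ` pverts ?G"
      by (intro image_eqI[of _ _ "(a, b)"]) (simp_all add: verts)
  qed
  have "eccentric_to ?G (a, b) (c, d) \<longleftrightarrow> cycle_dist n a c = n div 2 \<and> cycle_dist m b d = m div 2"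
    if "a < n" "b < m" "c < n" "d < m" for a b c d
    using that dist ecc cycle_dist_le[of n a c] cycle_dist_le[of m b d]
    by (auto simp: eccentric_to_def)
  \<comment> \<open>As \<open>n div 2\<close> is positive, adjacent vertices are automatically
    distinct.\<close>
  moreover have "a \<noteq> c" if "cycle_dist n a c = n div 2"
    using that assms(1) by (auto simp: cycle_dist_def)
  ultimately show ?thesis
    using cycle_dist_commute[of n a c] cycle_dist_commute[of m b d]
    by (auto simp: eccentric_graph_def verts)
qed

section \<open>Pairs at maximal distance in a cycle\<close>

text \<open>One of the two arcs has length \<open>n div 2\<close>, and either endpoint may be the
  larger number. The additive form avoids truncated subtraction.\<close>

lemma cycle_dist_eq_half:
  assumes "i < n" "j < n" "cycle_dist n i j = n div 2"
  shows "j = i + n div 2 \<or> i = j + n div 2 \<or> j + n div 2 = i + n \<or> i + n div 2 = j + n"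
proof -
  define d where "d = nat \<bar>int i - int j\<bar>"
  have "min d (n - d) = n div 2"
    using assms(3) by (simp only: cycle_dist_def d_def Let_def)
  moreover have "d < n"
    using assms(1,2) unfolding d_def by linarith
  ultimately have "d = n div 2 \<or> d + n div 2 = n"
    by linarith
  moreover have "j = i + d \<or> i = j + d"
    unfolding d_def by linarith
  ultimately show ?thesis
    by (elim disjE) simp_all
qed

text \<open>Modulo \<open>n\<close> the four alternatives collapse to two signed steps, which can be
  summed along a walk.\<close>

lemma int_cong_cycle_dist:
  assumes "i < n" "j < n" "cycle_dist n i j = n div 2"
  shows "[int j = int i + int (n div 2)] (mod int n) \<or> [int j = int i - int (n div 2)] (mod int n)"
proof -
  consider "j = i + n div 2" | "i = j + n div 2" | "j + n div 2 = i + n" | "i + n div 2 = j + n"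
    using cycle_dist_eq_half[OF assms] by blast
  then have "int n dvd int j - (int i + int (n div 2)) \<or> int n dvd int j - (int i - int (n div 2))"
  proof cases
    case 3
    then have "int j - (int i - int (n div 2)) = int n" by linarith
    then show ?thesis by simp
  next
    case 4
    then have "int j - (int i + int (n div 2)) = - int n" by linarith
    then show ?thesis by simp
  qed simp_all
  then show ?thesis
    by (simp add: cong_iff_dvd_diff)
qed

text \<open>On an even cycle both signed half turns lead to the same antipode, so two of them return
  to the start.\<close>

lemma cycle_dist_even_unique:
  assumes "even n" "i < n" "j < n" "k < n" "cycle_dist n i j = n div 2" "cycle_dist n j k = n div 2"
  shows "i = k"
proof -
  obtain h where "n = 2 * h" using assms(1) by (auto elim: evenE)
  with cycle_dist_eq_half[of i n j] cycle_dist_eq_half[of j n k] assms(2-) show ?thesis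
    by auto
qed

section \<open>Undirected cycles as vertex sequences\<close>

text \<open>Injectivity starts at index 1 because the library's cycles require distinctness of the
  tail of the vertex list. Values of \<open>v\<close> beyond \<open>k\<close> are
  irrelevant.\<close>

definition closed_trace :: "'a pair_pre_digraph \<Rightarrow> (nat \<Rightarrow> 'a) \<Rightarrow> nat \<Rightarrow> bool" where
  "closed_trace G v k \<longleftrightarrow>
    3 \<le> k \<and> v k = v 0 \<and> inj_on v {1..k} \<and> (\<forall>i<k. (v i, v (Suc i)) \<in> parcs G)"

lemma pcas_iff:
  "pcas u p w \<longleftrightarrow>
    (\<exists>v. v 0 = u \<and> v (length p) = w \<and> p = map (\<lambda>i. (v i, v (Suc i))) [0..<length p])"
proof (induction p arbitrary: u)
  case Nil
  show ?case by (auto intro: exI[of _ "\<lambda>_. w"])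
next
  case (Cons e p)
  have shift: "map (\<lambda>i. (v i, v (Suc i))) [0..<Suc (length p)] =
      (v 0, v 1) # map (\<lambda>i. (v (Suc i), v (Suc (Suc i)))) [0..<length p]" for v :: "nat \<Rightarrow> 'a"
  proof -
    have "[0..<Suc (length p)] = 0 # map Suc [0..<length p]"
      by (simp add: upt_conv_Cons map_Suc_upt del: upt_Suc)
    then show ?thesis by (simp only: list.map map_map comp_def One_nat_def)
  qed
  show ?case
  proof
    assume "pcas u (e # p) w"
    then have "fst e = u" and "pcas (snd e) p w"
      by auto
    with Cons.IH obtain v where "v 0 = snd e" "v (length p) = w"
      "p = map (\<lambda>i. (v i, v (Suc i))) [0..<length p]"
      by blast
    with \<open>fst e = u\<close> show "\<exists>v. v 0 = u \<and> v (length (e # p)) = w \<and>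
        e # p = map (\<lambda>i. (v i, v (Suc i))) [0..<length (e # p)]"
      \<comment> \<open>\<open>case_nat u v\<close> puts \<open>u\<close> in front of the sequence
        \<open>v\<close>.\<close>
      using shift[of "case_nat u v"] by (intro exI[of _ "case_nat u v"]) (simp add: prod_eq_iff del: upt_Suc)
  next
    assume "\<exists>v. v 0 = u \<and> v (length (e # p)) = w \<and>
        e # p = map (\<lambda>i. (v i, v (Suc i))) [0..<length (e # p)]"
    then obtain v where v: "v 0 = u" "v (Suc (length p)) = w" "e = (v 0, v 1)"
      "p = map (\<lambda>i. (v (Suc i), v (Suc (Suc i)))) [0..<length p]"
      by (auto simp: shift simp del: upt_Suc)
    then have "pcas (v 1) p w"
      by (subst Cons.IH) (auto intro!: exI[of _ "\<lambda>i. v (Suc i)"])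
    with v show "pcas u (e # p) w"
      by simp
  qed
qed

text \<open>The length is preserved both ways, so the girth can be studied by index arithmetic on
  vertex sequences instead of arc lists.\<close>

lemma undirected_cycle_iff_closed_trace:
  assumes "pair_wf_digraph G"
  shows "(\<exists>p. undirected_cycle G p \<and> length p = k) \<longleftrightarrow> (\<exists>v. closed_trace G v k)"
proof -
  interpret G: pair_wf_digraph G by fact
  have verts: "tl (G.awalk_verts u (map (\<lambda>i. (v i, v (Suc i))) [0..<k])) = map v [1..<Suc k]"
    if "0 < k" for u v
  proof -
    from that obtain j where "k = Suc j" by (cases k) auto
    then have "G.awalk_verts u (map (\<lambda>i. (v i, v (Suc i))) [0..<k]) = map v [0..<Suc k]"
      by (subst G.awalk_verts_conv) simp
    then show ?thesis
      by (simp add: map_tl[symmetric] tl_upt del: upt_Suc)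
  qed
  show ?thesis
  proof
    assume "\<exists>p. undirected_cycle G p \<and> length p = k"
    then obtain p u where p: "G.awalk u p u" "distinct (tl (G.awalk_verts u p))" "length p = k" "3 \<le> k"
      unfolding undirected_cycle_def G.cycle_def by blast
    then obtain v where v: "v 0 = u" "v k = u" "p = map (\<lambda>i. (v i, v (Suc i))) [0..<k]"
      unfolding G.awalk_def cas_with_proj_eq pcas_iff by blast
    have "distinct (map v [1..<Suc k])"
      using p v verts[of u v] by simp
    then have "inj_on v {1..k}"
      by (simp add: distinct_map atLeastLessThanSuc_atLeastAtMost del: upt_Suc)
    with p v have "closed_trace G v k"
      by (auto simp: closed_trace_def G.awalk_def)
    then show "\<exists>v. closed_trace G v k" by blast
  next
    assume "\<exists>v. closed_trace G v k"
    then obtain v where v: "3 \<le> k" "v k = v 0" "inj_on v {1..k}" "\<And>i. i < k \<Longrightarrow> (v i, v (Suc i)) \<in> parcs G"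
      by (auto simp: closed_trace_def)
    let ?p = "map (\<lambda>i. (v i, v (Suc i))) [0..<k]"
    have "pcas (v 0) ?p (v 0)"
      unfolding pcas_iff using v by (intro exI[of _ v]) simp
    moreover have "v 0 \<in> pverts G"
      using v(1) v(4)[of 0] G.in_arcsD1 by fastforce
    ultimately have "G.awalk (v 0) ?p (v 0)"
      using v by (auto simp: G.awalk_def)
    moreover have "distinct (tl (G.awalk_verts (v 0) ?p))"
      using v verts[of "v 0" v]
      by (simp add: distinct_map atLeastLessThanSuc_atLeastAtMost del: upt_Suc)
    ultimately have "undirected_cycle G ?p"
      using v(1) by (auto simp: undirected_cycle_def G.cycle_def)
    then show "\<exists>p. undirected_cycle G p \<and> length p = k"
      by force
  qed
qed

lemma girth_closed_trace:
  assumes "pair_wf_digraph G"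
  shows "girth G = (if \<exists>k v. closed_trace G v k then LEAST k. \<exists>v. closed_trace G v k else 0)"
proof -
  have "(\<exists>p. undirected_cycle G p) \<longleftrightarrow> (\<exists>k v. closed_trace G v k)"
    using undirected_cycle_iff_closed_trace[OF assms] by blast
  then show ?thesis
    by (simp add: girth_def undirected_cycle_iff_closed_trace[OF assms])
qed

lemma girth_eqI:
  assumes "pair_wf_digraph G" "closed_trace G v k" "\<And>w l. closed_trace G w l \<Longrightarrow> k \<le> l"
  shows "girth G = k"
proof -
  have "(LEAST k. \<exists>v. closed_trace G v k) = k"
    using assms(2,3) by (intro Least_equality) auto
  with assms(1,2) show ?thesis
    by (auto simp: girth_closed_trace)
qed

lemma closed_trace_no_backtrack:
  assumes "closed_trace G v k" "Suc (Suc i) \<le> k"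
  shows "v (Suc (Suc i)) \<noteq> v i"
proof -
  \<comment> \<open>Index 0 lies outside the range of injectivity and is replaced by
    \<open>k\<close>, where \<open>v\<close> has the same value; \<open>3 \<le> k\<close> keeps it
    different from 2.\<close>
  define j where "j = (if i = 0 then k else i)"
  have "v j = v i" "j \<in> {1..k}" "Suc (Suc i) \<in> {1..k}" "j \<noteq> Suc (Suc i)"
    using assms by (auto simp: closed_trace_def j_def)
  moreover have "inj_on v {1..k}"
    using assms(1) by (simp add: closed_trace_def)
  ultimately show ?thesis
    by (metis inj_onD)
qed

section \<open>Closed traces in the eccentric graph of the product\<close>

abbreviation eccentric_torus :: "nat \<Rightarrow> nat \<Rightarrow> (nat \<times> nat) pair_pre_digraph" where
  "eccentric_torus n m \<equiv> eccentric_graph (cycle_graph n \<box> cycle_graph m)"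

lemma pair_wf_digraph_eccentric_torus:
  assumes "3 \<le> n" "3 \<le> m"
  shows "pair_wf_digraph (eccentric_torus n m)"
proof -
  interpret pair_graph "eccentric_torus n m"
    using assms
    by (intro pair_graph_eccentric_graph pair_graph_cartesian_product pair_graph_cycle_graph)
  show ?thesis by (rule pair_wf_digraph_axioms)
qed

lemma closed_trace_torusD:
  assumes "3 \<le> n" "3 \<le> m" "closed_trace (eccentric_torus n m) v k" "i < k"
  shows "fst (v i) < n" "snd (v i) < m" "fst (v (Suc i)) < n" "snd (v (Suc i)) < m"
    "cycle_dist n (fst (v i)) (fst (v (Suc i))) = n div 2"
    "cycle_dist m (snd (v i)) (snd (v (Suc i))) = m div 2"
proof -
  have "((fst (v i), snd (v i)), (fst (v (Suc i)), snd (v (Suc i)))) \<in> parcs (eccentric_torus n m)"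
    using assms(3,4) by (simp add: closed_trace_def)
  then show "fst (v i) < n" "snd (v i) < m" "fst (v (Suc i)) < n" "snd (v (Suc i)) < m"
    "cycle_dist n (fst (v i)) (fst (v (Suc i))) = n div 2"
    "cycle_dist m (snd (v i)) (snd (v (Suc i))) = m div 2"
    unfolding parcs_eccentric_graph_torus[OF assms(1,2)] by auto
qed

text \<open>Swapping the coordinates maps closed traces to closed traces of the same length.\<close>

lemma girth_eccentric_torus_commute:
  assumes "3 \<le> n" "3 \<le> m"
  shows "girth (eccentric_torus n m) = girth (eccentric_torus m n)"
proof -
  have "closed_trace (eccentric_torus m n) (prod.swap \<circ> v) k"
    if "3 \<le> n" "3 \<le> m" "closed_trace (eccentric_torus n m) v k" for n m v k
  proof -
    have "inj_on (prod.swap \<circ> v) {1..k}"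
      using that(3) by (intro comp_inj_on) (auto simp: closed_trace_def)
    moreover have "((prod.swap \<circ> v) i, (prod.swap \<circ> v) (Suc i)) \<in> parcs (eccentric_torus m n)"
      if "i < k" for i
      using closed_trace_torusD[OF \<open>3 \<le> n\<close> \<open>3 \<le> m\<close> \<open>closed_trace _ v k\<close> that]
      by (cases "v i"; cases "v (Suc i)")
        (simp add: parcs_eccentric_graph_torus[OF \<open>3 \<le> m\<close> \<open>3 \<le> n\<close>])
    ultimately show ?thesis
      using that(3) by (simp add: closed_trace_def)
  qed
  then have "(\<exists>v. closed_trace (eccentric_torus n m) v k) \<longleftrightarrow> (\<exists>v. closed_trace (eccentric_torus m n) v k)" for k
    using assms by blast
  then show ?thesis
    using assms by (simp add: girth_closed_trace pair_wf_digraph_eccentric_torus)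
qed

section \<open>The girth by parity\<close>

text \<open>Each vertex has only its antipode as neighbour, so any two consecutive steps
  backtrack.\<close>

lemma girth_even_even:
  assumes "3 \<le> n" "3 \<le> m" "even n" "even m"
  shows "girth (eccentric_torus n m) = 0"
proof -
  have False if c: "closed_trace (eccentric_torus n m) v k" for v k
  proof -
    have "3 \<le> k" using c by (simp add: closed_trace_def)
    then have k: "0 < k" "Suc 0 < k" "Suc (Suc 0) \<le> k" by auto
    note 0 = closed_trace_torusD[OF assms(1,2) c k(1)] and 1 = closed_trace_torusD[OF assms(1,2) c k(2)]
    have "fst (v 0) = fst (v (Suc (Suc 0)))" "snd (v 0) = snd (v (Suc (Suc 0)))"
      using cycle_dist_even_unique[OF assms(3)] cycle_dist_even_unique[OF assms(4)] 0 1 by blast+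
    then show False
      using closed_trace_no_backtrack[OF c k(3)] by (simp add: prod_eq_iff)
  qed
  with assms(1,2) show ?thesis
    by (auto simp: girth_closed_trace pair_wf_digraph_eccentric_torus)
qed

section \<open>One even and one odd cycle length\<close>

lemma coprime_half_odd:
  assumes "odd (m :: nat)"
  shows "coprime (m div 2) m"
proof -
  from assms obtain h where "m = 2 * h + 1" by (auto elim: oddE)
  then show ?thesis
    using gcd_add_mult[of h 2 1] by (simp add: coprime_iff_gcd_eq_1)
qed

text \<open>The first coordinate alternates between two antipodes while the second advances by
  \<open>m div 2\<close>, a unit modulo \<open>m\<close>. The trace can therefore return only after
  an even multiple of \<open>m\<close> steps.\<close>

lemma closed_trace_even_odd:
  assumes "3 \<le> n" "3 \<le> m" "even n" "odd m"
  shows "closed_trace (eccentric_torus n m) (\<lambda>i. (if even i then 0 else n div 2, (i * (m div 2)) mod m)) (2 * m)"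
    (is "closed_trace _ ?v _")
proof -
  have "inj_on ?v {1..2 * m}"
  proof (rule inj_onI)
    fix i j assume ij: "i \<in> {1..2 * m}" "j \<in> {1..2 * m}" "?v i = ?v j"
    then have "[i * (m div 2) = j * (m div 2)] (mod m)"
      by (simp add: cong_def)
    then have "[i = j] (mod m)"
      using coprime_half_odd[OF assms(4)] by (simp add: cong_mult_rcancel_nat)
    then have "int m dvd int i - int j"
      by (simp add: cong_iff_dvd_diff flip: cong_int_iff)
    moreover have "even i \<longleftrightarrow> even j"
      using ij(3) assms(1) by (auto split: if_splits)
    then have "2 dvd int i - int j"
      by simp
    \<comment> \<open>As \<open>m\<close> is odd, divisibility by 2 and by \<open>m\<close> combine;
      the indices differ by less than \<open>2 * m\<close>, so they are equal.\<close>
    ultimately have "2 * int m dvd int i - int j"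
      using assms(4) by (intro divides_mult) auto
    moreover have "\<bar>int i - int j\<bar> < 2 * int m"
      using ij(1,2) by auto
    ultimately show "i = j"
      using zdvd_not_zless[of "\<bar>int i - int j\<bar>" "2 * int m"] by (cases "i = j") auto
  qed
  moreover have "(?v i, ?v (Suc i)) \<in> parcs (eccentric_torus n m)" for i
  proof -
    define x where "x = (i * (m div 2)) mod m"
    have "(Suc i * (m div 2)) mod m = (x + m div 2) mod m"
      by (simp add: x_def mod_simps add.commute)
    \<comment> \<open>The sum is below \<open>2 * m\<close>, so at most one subtraction of
      \<open>m\<close> reduces it.\<close>
    also have "\<dots> = (if x + m div 2 < m then x + m div 2 else x + m div 2 - m)"
    proof -
      have "x < m" using assms(2) by (simp add: x_def)
      then show ?thesis by (auto simp: mod_if)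
    qed
    finally have y: "(Suc i * (m div 2)) mod m = (if x + m div 2 < m then x + m div 2 else x + m div 2 - m)" .
    have "x < m" using assms(2) by (simp add: x_def)
    with assms show ?thesis
      unfolding parcs_eccentric_graph_torus[OF assms(1,2)] y x_def[symmetric]
      by (auto simp: cycle_dist_def Let_def)
  qed
  ultimately show ?thesis
    using assms(2) by (simp add: closed_trace_def)
qed

text \<open>
  The first coordinate alternates, so a cycle cannot reverse direction in the second
  coordinate without backtracking.
\<close>

lemma closed_trace_even_odd_length:
  assumes "3 \<le> n" "3 \<le> m" "even n" "odd m" and c: "closed_trace (eccentric_torus n m) v k"
  shows "2 * m dvd k"
proof -
  define a where "a i = int (fst (v i))" for i
  define b where "b i = int (snd (v i))" for i
  define h where "h = int (m div 2)"
  note D = closed_trace_torusD[OF assms(1,2) c]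
  have k: "3 \<le> k" "v k = v 0" using c by (auto simp: closed_trace_def)
  have a_step: "[a (Suc i) = a i + int (n div 2)] (mod int n)" if "i < k" for i
  proof -
    \<comment> \<open>For even \<open>n\<close> the two signed steps differ by exactly
      \<open>n\<close>, so the sign can be fixed.\<close>
    have "[a i - int (n div 2) = a i + int (n div 2)] (mod int n)"
      using assms(3) by (auto simp: cong_iff_dvd_diff elim!: evenE)
    then show ?thesis
      using int_cong_cycle_dist[of "fst (v i)" n "fst (v (Suc i))"] D[OF that]
      unfolding a_def by (meson cong_trans)
  qed
  have b_step: "[b (Suc i) = b i + h] (mod int m) \<or> [b (Suc i) = b i - h] (mod int m)" if "i < k" for i
    using int_cong_cycle_dist[of "snd (v i)" m "snd (v (Suc i))"] D[OF that] unfolding b_def h_def by blast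
  have b_ne: "\<not> [b (Suc (Suc i)) = b i] (mod int m)" if "Suc i < k" for i
  proof
    assume "[b (Suc (Suc i)) = b i] (mod int m)"
    then have "snd (v (Suc (Suc i))) = snd (v i)"
      using D[of i] D[of "Suc i"] that unfolding b_def cong_int_iff
      by (simp add: cong_def)
    moreover have "fst (v i) = fst (v (Suc (Suc i)))"
      using D[of i] D[of "Suc i"] that cycle_dist_even_unique[OF assms(3)] by simp
    ultimately show False
      using closed_trace_no_backtrack[OF c, of i] that by (simp add: prod_eq_iff)
  qed
  have dir: "[b (Suc (Suc i)) = b (Suc i) + s] (mod int m)"
    if i: "Suc i < k" and s: "s \<in> {h, -h}" "[b (Suc i) = b i + s] (mod int m)" for i s
  proof (rule ccontr)
    assume "\<not> ?thesis"
    then have "[b (Suc (Suc i)) = b (Suc i) - s] (mod int m)"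
      using b_step[OF i] s(1) by auto
    also have "[b (Suc i) - s = b i + s - s] (mod int m)"
      using s(2) by (intro cong_diff) auto
    finally show False
      using b_ne[OF i] by simp
  qed
  have "\<exists>s\<in>{h, -h}. [b (Suc 0) = b 0 + s] (mod int m)"
    using b_step[of 0] k(1) by auto
  then obtain s where s: "s \<in> {h, -h}" "[b (Suc 0) = b 0 + s] (mod int m)"
    by blast
  have s_step: "[b (Suc i) = b i + s] (mod int m)" if "i < k" for i
    using that by (induction i) (use s dir in auto)
  have b_sum: "[b i = b 0 + int i * s] (mod int m)" if "i \<le> k" for i
    using that
  proof (induction i)
    case (Suc i)
    then have "[b (Suc i) = b 0 + int i * s + s] (mod int m)"
      using s_step[of i] by (meson Suc_le_eq cong_add_rcancel cong_trans less_imp_le)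
    then show ?case by (simp add: algebra_simps)
  qed simp
  have a_sum: "[a i = a 0 + int i * int (n div 2)] (mod int n)" if "i \<le> k" for i
    using that
  proof (induction i)
    case (Suc i)
    then have "[a (Suc i) = a 0 + int i * int (n div 2) + int (n div 2)] (mod int n)"
      using a_step[of i] by (meson Suc_le_eq cong_add_rcancel cong_trans less_imp_le)
    then show ?case by (simp add: algebra_simps)
  qed simp
  \<comment> \<open>The trace closes after \<open>k\<close> steps of constant value
    \<open>s\<close>, which is \<open>h\<close> up to sign and hence coprime to \<open>m\<close>; so
    \<open>m\<close> divides \<open>k\<close>.\<close>
  have "int m dvd int k * s"
    using b_sum[of k] k(2) by (simp add: b_def cong_iff_dvd_diff)
  then have "int m dvd int k * h"
    using s(1) by auto
  moreover have "coprime (int m) h"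
    using coprime_half_odd[OF assms(4)] by (simp add: h_def coprime_commute)
  ultimately have "int m dvd int k"
    by (simp add: coprime_dvd_mult_left_iff)
  \<comment> \<open>In the first coordinate, \<open>k\<close> half turns close up only for even
    \<open>k\<close>.\<close>
  moreover have "int n dvd int k * int (n div 2)"
    using a_sum[of k] k(2) by (simp add: a_def cong_iff_dvd_diff)
  then have "even k"
    using assms(1,3) by (auto elim!: evenE)
  ultimately show ?thesis
    using assms(4) by (intro divides_mult) auto
qed

lemma girth_even_odd:
  assumes "3 \<le> n" "3 \<le> m" "even n" "odd m"
  shows "girth (eccentric_torus n m) = 2 * m"
proof (rule girth_eqI[OF pair_wf_digraph_eccentric_torus[OF assms(1,2)] closed_trace_even_odd[OF assms]])
  fix w l assume c: "closed_trace (eccentric_torus n m) w l"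
  then have "0 < l" by (simp add: closed_trace_def)
  with closed_trace_even_odd_length[OF assms c] show "2 * m \<le> l"
    by (rule dvd_imp_le)
qed

section \<open>Two odd cycle lengths\<close>

text \<open>With \<open>n = 2 * h + 1\<close>, three steps of plus or minus \<open>h\<close> sum to
  \<open>h\<close> or \<open>3 * h\<close> up to sign. The former is nonzero modulo
  \<open>n\<close>, and the latter is congruent to \<open>h - 1\<close>, which vanishes only for
  \<open>h = 1\<close>.\<close>

lemma cycle_dist_odd_triangle:
  assumes "3 \<le> n" "odd n" "i < n" "j < n" "k < n"
    "cycle_dist n i j = n div 2" "cycle_dist n j k = n div 2" "cycle_dist n k i = n div 2"
  shows "n = 3"
proof -
  obtain h where h: "n = 2 * h + 1" using assms(2) by (auto elim: oddE)
  then have "n div 2 = h" by simp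
  with cycle_dist_eq_half[of i n j] cycle_dist_eq_half[of j n k] cycle_dist_eq_half[of k n i] h assms
  show ?thesis
    by auto
qed

lemma girth_three_three: "girth (eccentric_torus 3 3) = 3"
proof (rule girth_eqI)
  have "{1..3::nat} = {1, 2, 3}" by auto
  then have "inj_on (\<lambda>i. (i mod 3, i mod 3)) {1..3::nat}"
    by simp
  moreover have "cycle_dist 3 (i mod 3) (Suc i mod 3) = 3 div 2" if "i < 3" for i
  proof -
    from that consider "i = 0" | "i = 1" | "i = 2" by linarith
    then show ?thesis by cases (simp_all add: cycle_dist_def)
  qed
  ultimately show "closed_trace (eccentric_torus 3 3) (\<lambda>i. (i mod 3, i mod 3)) 3"
    by (auto simp: closed_trace_def parcs_eccentric_graph_torus)
qed (simp_all add: pair_wf_digraph_eccentric_torus closed_trace_def)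

text \<open>A triangle would project to triangles in both factors and force
  \<open>n = m = 3\<close>, while a 4-cycle always exists.\<close>

lemma girth_odd_odd:
  assumes "3 \<le> n" "3 \<le> m" "odd n" "odd m" "\<not> (n = 3 \<and> m = 3)"
  shows "girth (eccentric_torus n m) = 4"
proof (rule girth_eqI[OF pair_wf_digraph_eccentric_torus[OF assms(1,2)]])
  define h where "h = n div 2"
  define l where "l = m div 2"
  have h: "n = 2 * h + 1" "1 \<le> h" and l: "m = 2 * l + 1" "1 \<le> l"
    using assms by (auto simp: h_def l_def elim!: oddE)
  \<comment> \<open>In the first factor \<open>h\<close> has the two farthest vertices 0 and
    \<open>n - 1\<close>; in the second, 0 has \<open>l\<close> and \<open>l + 1\<close>.
    Alternating these choices gives the 4-cycle.\<close>
  let ?v = "\<lambda>i. [(0, 0), (h, l), (n - 1, 0), (h, l + 1), (0, 0)] ! i"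
  have "{1..4::nat} = {1, 2, 3, 4}" by auto
  then have "inj_on ?v {1..4}"
    using h l by simp
  moreover have "(?v i, ?v (Suc i)) \<in> parcs (eccentric_torus n m)" if "i < 4" for i
  proof -
    from that consider "i = 0" | "i = 1" | "i = 2" | "i = 3" by linarith
    then show ?thesis
      by cases (use h l in \<open>auto simp: parcs_eccentric_graph_torus cycle_dist_def Let_def\<close>)
  qed
  ultimately show "closed_trace (eccentric_torus n m) ?v 4"
    by (simp add: closed_trace_def)
next
  fix w k assume c: "closed_trace (eccentric_torus n m) w k"
  show "4 \<le> k"
  proof (rule ccontr)
    assume "\<not> 4 \<le> k"
    with c have "k = 3"
      by (simp add: closed_trace_def)
    with c have k: "k = 3" "w 3 = w 0"
      by (auto simp: closed_trace_def)
    note D = closed_trace_torusD[OF assms(1,2) c]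
    have "n = 3"
      using cycle_dist_odd_triangle[OF assms(1,3), of "fst (w 0)" "fst (w 1)" "fst (w 2)"]
        D[of 0] D[of 1] D[of 2] k by (simp add: numeral_3_eq_3 numeral_2_eq_2)
    moreover have "m = 3"
      using cycle_dist_odd_triangle[OF assms(2,4), of "snd (w 0)" "snd (w 1)" "snd (w 2)"]
        D[of 0] D[of 1] D[of 2] k by (simp add: numeral_3_eq_3 numeral_2_eq_2)
    ultimately show False
      using assms(5) by simp
  qed
qed

theorem mainTheorem8:
  fixes n m :: nat
  assumes "3 \<le> n" and "3 \<le> m"
  defines "g \<equiv> girth (eccentric_graph (cycle_graph n \<box> cycle_graph m))"
  shows "(even n \<and> even m \<longrightarrow> g = 0)
    \<and> (n = 3 \<and> m = 3 \<longrightarrow> g = 3)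
    \<and> (even n \<and> odd m \<longrightarrow> g = 2 * m)
    \<and> (odd n \<and> even m \<longrightarrow> g = 2 * n)
    \<and> (odd n \<and> odd m \<and> \<not> (n = 3 \<and> m = 3) \<longrightarrow> g = 4)
    \<and> (even g \<longleftrightarrow> \<not> (n = 3 \<and> m = 3))"
proof -
  have "g = 0" if "even n" "even m"
    using girth_even_even assms(1,2) that by (simp add: g_def)
  moreover have "g = 3" if "n = 3" "m = 3"
    using girth_three_three that by (simp add: g_def)
  moreover have "g = 2 * m" if "even n" "odd m"
    using girth_even_odd assms(1,2) that by (simp add: g_def)
  moreover have "g = 2 * n" if "odd n" "even m"
    using girth_even_odd[of m n] girth_eccentric_torus_commute[of n m] assms(1,2) that
    by (simp add: g_def)
  moreover have "g = 4" if "odd n" "odd m" "\<not> (n = 3 \<and> m = 3)"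
    using girth_odd_odd assms(1,2) that by (simp add: g_def)
  ultimately show ?thesis
    by (cases "even n"; cases "even m") auto
qed

end
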